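(* Let $\mathcal{S}$ be a trajectory set, let $f\in Q$, let $\rho\le\tau$ be two stopping times on $\mathcal{S}$, and set $f_j=\overline{\sigma}_jf$ for $j\ge0$. Then: 1. $\overline{\sigma}_\rho f^\tau_k\le f^\rho_k$ on $\mathcal{S}$ for all $k\ge0$, where $f^\tau_k(S)=f_{\tau(S)\wedge k}(S)$ and $f^\rho_k(S)=f_{\rho(S)\wedge k}(S)$. 2. $\overline{\sigma}_\rho f_\tau\le f_\rho$ on $\mathcal{S}$.
   Context: Fix $s_0\in\mathbb{R}$. A trajectory set $\mathcal{S}$ is a set of real sequences $S=(S_i)_{i\ge 0}$ with $S_0=s_0$. For $S\in\mathcal{S}$ and an integer $j\ge 0$, the node $(S,j)$ stands for $\mathcal{S}_{(S,j)}=\{\tilde S\in\mathcal{S}:\tilde S_i=S_i,\ 0\le i\le j\}$; also $\mathcal{S}_{(S,\infty)}=\{S\}$. $\mathcal{H}_{(S,j)}$ is the set of sequences $H=(H_i)_{i\ge j}$ of functions $H_i:\mathcal{S}_{(S,j)}\to\mathbb{R}$ that are non-anticipative: $H_i(\tilde S)=H_i(\hat S)$ whenever $\tilde S_k=\hat S_k$ for $j\le k\le i$. For $V\in\mathbb{R}$, $H\in\mathcal{H}_{(S,j)}$, $n\ge j$, put $\Pi^{V,H}_{j,n}(\tilde S)=V+\sum_{i=j}^{n-1}H_i(\tilde S)(\tilde S_{i+1}-\tilde S_i)$ for $\tilde S\in\mathcal{S}_{(S,j)}$. $\mathcal{E}_{(S,j)}$ is the set of all such functions $\Pi^{V,H}_{j,n}$,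 and $\mathcal{E}^+_{(S,j)}$ the set of its non-negative elements. $Q$ is the set of all functions $\mathcal{S}\to[-\infty,\infty]$. Conventions: $0\cdot(\pm\infty)=0$, $\infty+(-\infty)=\infty$, $u-v=u+(-v)$, $\inf\emptyset=\infty$. For $f\in Q$ and a node $(S,j)$, $\overline{\sigma}_jf(S)=\inf\sum_{m\ge 0}V^m$, the infimum being over all choices of $f_0=\Pi^{V^0,H^0}_{j,n_0}\in\mathcal{E}_{(S,j)}$ and, for $m\ge1$, $f_m=\liminf_{n\to\infty}\Pi^{V^m,H^m}_{j,n}$ with $\Pi^{V^m,H^m}_{j,n}\in\mathcal{E}^+_{(S,j)}$ for all $n\ge j$, such that $f\le\sum_{m\ge0}f_m$ on $\mathcal{S}_{(S,j)}$. Put $\overline{\sigma}_\infty f(S)=f(S)$; in particular $f_\infty=\overline{\sigma}_\infty f=f$ for the sequence $f_j=\overline{\sigma}_jf$. A stopping time is a function $\tau:\mathcal{S}\to\{0,1,2,\dots\}\cup\{\infty\}$ such that for all $S,S'\in\mathcal{S}$, if $S_k=S'_k$ for all $0\le k\le\tau(S)$ (all $k\geq 0$ if $\tau(S)=\infty$), then $\tau(S)=\tau(S')$. For a stopping time $\tau$, $\overline{\sigma}_\tau g(S)=\overline{\sigma}_{\tau(S)}g(S)$ for $g\in Q$, and $f_\tau(S)=f_{\tau(S)}(S)$. *)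

theory Defs
  imports "HOL-Library.Extended_Real"
begin

text \<open>
  The arithmetic of \<^typ>\<open>ereal\<close> is the intended one: \<open>\<infinity> + (-\<infinity>) = \<infinity>\<close>, \<open>u - v = u + (-v)\<close>,
  \<open>0 * (\<plusminus>\<infinity>) = 0\<close>, \<open>Inf {} = \<infinity>\<close>. Functions on a trajectory set or on a node are total functions
  on sequences of which only the values on that set are ever constrained or used.
\<close>

definition trajectory_set :: "real \<Rightarrow> (nat \<Rightarrow> real) set \<Rightarrow> bool" where
  "trajectory_set s0 \<S> \<longleftrightarrow> (\<forall>S\<in>\<S>. S 0 = s0)"

definition node :: "(nat \<Rightarrow> real) set \<Rightarrow> (nat \<Rightarrow> real) \<Rightarrow> nat \<Rightarrow> (nat \<Rightarrow> real) set" where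
  "node \<S> S j = {T \<in> \<S>. \<forall>i\<le>j. T i = S i}"

definition strategies ::
  "(nat \<Rightarrow> real) set \<Rightarrow> (nat \<Rightarrow> real) \<Rightarrow> nat \<Rightarrow> (nat \<Rightarrow> (nat \<Rightarrow> real) \<Rightarrow> real) set" where
  "strategies \<S> S j =
    {H. \<forall>i\<ge>j. \<forall>T\<in>node \<S> S j. \<forall>U\<in>node \<S> S j.
          (\<forall>k. j \<le> k \<and> k \<le> i \<longrightarrow> T k = U k) \<longrightarrow> H i T = H i U}"

definition portfolio ::
  "nat \<Rightarrow> real \<Rightarrow> (nat \<Rightarrow> (nat \<Rightarrow> real) \<Rightarrow> real) \<Rightarrow> nat \<Rightarrow> (nat \<Rightarrow> real) \<Rightarrow> real" where
  "portfolio j V H n T = V + (\<Sum>i = j..<n. H i T * (T (i + 1) - T i))"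

definition elementary ::
  "(nat \<Rightarrow> real) set \<Rightarrow> (nat \<Rightarrow> real) \<Rightarrow> nat \<Rightarrow> ((nat \<Rightarrow> real) \<Rightarrow> real) set" where
  "elementary \<S> S j =
    {g. \<exists>V. \<exists>H\<in>strategies \<S> S j. \<exists>n\<ge>j. \<forall>T\<in>node \<S> S j. g T = portfolio j V H n T}"

definition elementary_nonneg ::
  "(nat \<Rightarrow> real) set \<Rightarrow> (nat \<Rightarrow> real) \<Rightarrow> nat \<Rightarrow> ((nat \<Rightarrow> real) \<Rightarrow> real) set" where
  "elementary_nonneg \<S> S j = {g \<in> elementary \<S> S j. \<forall>T\<in>node \<S> S j. 0 \<le> g T}"

text \<open>
  The functions \<open>f_m\<close> of a superhedge: a simple portfolio for \<open>m = 0\<close>, a lower limit for \<open>m \<ge> 1\<close>.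
\<close>

definition hedge ::
  "nat \<Rightarrow> (nat \<Rightarrow> real) \<Rightarrow> (nat \<Rightarrow> nat \<Rightarrow> (nat \<Rightarrow> real) \<Rightarrow> real) \<Rightarrow> nat
    \<Rightarrow> nat \<Rightarrow> (nat \<Rightarrow> real) \<Rightarrow> ereal" where
  "hedge j V H n0 m T =
    (if m = 0 then ereal (portfolio j (V 0) (H 0) n0 T)
     else liminf (\<lambda>n. ereal (portfolio j (V m) (H m) n T)))"

text \<open>
  Taking \<open>n = j\<close> in the nonnegativity condition gives \<open>V m \<ge> 0\<close> for \<open>m \<ge> 1\<close>, so both series below
  converge in \<^typ>\<open>ereal\<close> and \<^const>\<open>suminf\<close> is their value.
\<close>

definition sigma_node ::
  "(nat \<Rightarrow> real) set \<Rightarrow> nat \<Rightarrow> ((nat \<Rightarrow> real) \<Rightarrow> ereal) \<Rightarrow> (nat \<Rightarrow> real) \<Rightarrow> ereal" where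
  "sigma_node \<S> j f S =
    Inf {(\<Sum>m. ereal (V m)) | V H n0.
           (\<forall>m. H m \<in> strategies \<S> S j) \<and> n0 \<ge> j \<and>
           (\<forall>m\<ge>1. \<forall>n\<ge>j. portfolio j (V m) (H m) n \<in> elementary_nonneg \<S> S j) \<and>
           (\<forall>T\<in>node \<S> S j. f T \<le> (\<Sum>m. hedge j V H n0 m T))}"

definition sigma_bar ::
  "(nat \<Rightarrow> real) set \<Rightarrow> enat \<Rightarrow> ((nat \<Rightarrow> real) \<Rightarrow> ereal) \<Rightarrow> (nat \<Rightarrow> real) \<Rightarrow> ereal" where
  "sigma_bar \<S> t f S = (case t of enat j \<Rightarrow> sigma_node \<S> j f S | \<infinity> \<Rightarrow> f S)"

definition stopping_time :: "(nat \<Rightarrow> real) set \<Rightarrow> ((nat \<Rightarrow> real) \<Rightarrow> enat) \<Rightarrow> bool" where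
  "stopping_time \<S> \<tau> \<longleftrightarrow>
    (\<forall>S\<in>\<S>. \<forall>S'\<in>\<S>. (\<forall>k. enat k \<le> \<tau> S \<longrightarrow> S k = S' k) \<longrightarrow> \<tau> S = \<tau> S')"

definition sigma_stop ::
  "(nat \<Rightarrow> real) set \<Rightarrow> ((nat \<Rightarrow> real) \<Rightarrow> enat) \<Rightarrow> ((nat \<Rightarrow> real) \<Rightarrow> ereal)
    \<Rightarrow> (nat \<Rightarrow> real) \<Rightarrow> ereal" where
  "sigma_stop \<S> \<tau> g S = sigma_bar \<S> (\<tau> S) g S"

end

theory Submission
  imports Defs
begin

text \<open>
  A superhedge of \<open>f\<close> at a node \<open>(S, j)\<close>, stopped at \<open>\<tau> \<ge> j\<close>, is a superhedge of \<open>f\<^sub>\<tau>\<close> at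
  the same cost: its value at time \<open>\<tau>\<close> is the cost of continuing the unstopped one from there, and
  that continuation superhedges \<open>f\<close>. When \<open>\<rho> S = j \<le> k\<close>, both claims are instances
  of this (with \<open>\<tau>\<close> or \<open>\<tau> \<and> k\<close>). When \<open>\<rho> S > k\<close>, the function \<open>f\<^sub>k\<close> to be hedged
  is constant on the node.
\<close>

section \<open>Nodes and non-anticipating strategies\<close>

lemma node_trans:
  assumes "U \<in> node \<S> T t" "T \<in> node \<S> S j" "j \<le> t"
  shows "U \<in> node \<S> S j"
  using assms by (auto simp: node_def)

lemma node_cong: "T \<in> node \<S> S j \<Longrightarrow> node \<S> T j = node \<S> S j"
  by (auto simp: node_def)

lemma strategies_cong: "T \<in> node \<S> S j \<Longrightarrow> strategies \<S> T j = strategies \<S> S j"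
  by (simp add: strategies_def node_cong)

lemma sigma_node_cong:
  assumes "T \<in> node \<S> S j"
  shows "sigma_node \<S> j f T = sigma_node \<S> j f S"
proof -
  have "elementary_nonneg \<S> T j = elementary_nonneg \<S> S j"
    by (simp add: elementary_nonneg_def elementary_def node_cong[OF assms] strategies_cong[OF assms])
  then show ?thesis
    by (simp add: sigma_node_def node_cong[OF assms] strategies_cong[OF assms])
qed

lemma strategiesD:
  assumes "H \<in> strategies \<S> S j" "T \<in> node \<S> S j" "U \<in> node \<S> S j" "j \<le> i"
    "\<And>k. j \<le> k \<Longrightarrow> k \<le> i \<Longrightarrow> T k = U k"
  shows "H i T = H i U"
  using assms unfolding strategies_def by blast

text \<open>All trajectories in \<open>node \<S> T t\<close> agree with \<open>T\<close> up to
  \<open>t\<close>, so there agreement from \<open>t\<close> on already gives agreement from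
  \<open>j\<close> on.\<close>

lemma strategies_restrict:
  assumes H: "H \<in> strategies \<S> S j" and T: "T \<in> node \<S> S j" and "j \<le> t"
  shows "H \<in> strategies \<S> T t"
  unfolding strategies_def
proof (intro CollectI allI impI ballI)
  fix i U W
  assume i: "t \<le> i" and U: "U \<in> node \<S> T t" and W: "W \<in> node \<S> T t"
    and eq: "\<forall>k. t \<le> k \<and> k \<le> i \<longrightarrow> U k = W k"
  have "U k = W k" if "k \<le> i" for k
    using that eq U W by (cases "t \<le> k") (auto simp: node_def)
  then show "H i U = H i W"
    using strategiesD[OF H node_trans[OF U T \<open>j \<le> t\<close>] node_trans[OF W T \<open>j \<le> t\<close>], of i]
      i \<open>j \<le> t\<close> by simp
qed

text \<open>The rule for closing a position must itself be non-anticipating. \<open>P i\<close> may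
  look at the whole past from time 0, since trajectories in the node share their past up to
  \<open>j\<close>.\<close>

lemma strategies_if:
  assumes H: "H \<in> strategies \<S> S j"
    and P: "\<And>i T U. j \<le> i \<Longrightarrow> T \<in> node \<S> S j \<Longrightarrow> U \<in> node \<S> S j \<Longrightarrow>
      (\<And>k. k \<le> i \<Longrightarrow> T k = U k) \<Longrightarrow> P i T = P i U"
  shows "(\<lambda>i T. if P i T then H i T else 0) \<in> strategies \<S> S j"
  unfolding strategies_def
proof (intro CollectI allI impI ballI)
  fix i T U
  assume i: "j \<le> i" and T: "T \<in> node \<S> S j" and U: "U \<in> node \<S> S j"
    and eq: "\<forall>k. j \<le> k \<and> k \<le> i \<longrightarrow> T k = U k"
  have "T k = U k" if "k \<le> i" for k
    using that eq T U by (cases "j \<le> k") (auto simp: node_def)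
  then have "P i T = P i U" using P[OF i T U] by simp
  moreover have "H i T = H i U" using strategiesD[OF H T U i] eq by simp
  ultimately show "(if P i T then H i T else 0) = (if P i U then H i U else 0)" by simp
qed

section \<open>Stopping times\<close>

text \<open>If \<tau> is at most \<open>i\<close> on either path, agreement up to \<open>i\<close>
  covers agreement up to that value, so both values coincide.\<close>

lemma stopping_time_less_iff:
  assumes "stopping_time \<S> \<tau>" "T \<in> \<S>" "U \<in> \<S>" "\<And>k. k \<le> i \<Longrightarrow> T k = U k"
  shows "enat i < \<tau> T \<longleftrightarrow> enat i < \<tau> U"
proof -
  have "\<tau> A = \<tau> B" if "A \<in> \<S>" "B \<in> \<S>" "\<And>k. k \<le> i \<Longrightarrow> A k = B k" "\<not> enat i < \<tau> A" for A B
  proof -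
    have "A k = B k" if "enat k \<le> \<tau> A" for k
      using that \<open>\<not> enat i < \<tau> A\<close> \<open>\<And>k. k \<le> i \<Longrightarrow> A k = B k\<close>
      by (metis enat_ord_simps(1) not_less order_trans)
    then show ?thesis using assms(1) that(1,2) unfolding stopping_time_def by blast
  qed
  from this[of T U] this[of U T] show ?thesis using assms by fastforce
qed

lemma stopping_time_min_const:
  assumes "stopping_time \<S> \<tau>"
  shows "stopping_time \<S> (\<lambda>T. min (\<tau> T) (enat k))"
  unfolding stopping_time_def
proof (intro ballI impI)
  fix S S' assume S: "S \<in> \<S>" "S' \<in> \<S>"
    and eq: "\<forall>i. enat i \<le> min (\<tau> S) (enat k) \<longrightarrow> S i = S' i"
  show "min (\<tau> S) (enat k) = min (\<tau> S') (enat k)"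
  proof (cases "\<tau> S \<le> enat k")
    case True
    then show ?thesis using eq S assms unfolding stopping_time_def by (metis min.absorb1)
  next
    case False
    then have "S i = S' i" if "i \<le> k" for i
      using eq that by (simp add: min_def)
    then have "enat k < \<tau> S'"
      using False stopping_time_less_iff[OF assms S, of k] by (simp add: not_le)
    then show ?thesis using False by (simp add: min_def flip: not_less)
  qed
qed

section \<open>Portfolios under cutoff, stopping and restart\<close>

lemma portfolio_cong:
  assumes "\<And>i. j \<le> i \<Longrightarrow> i < n \<Longrightarrow> H i T = H' i T"
  shows "portfolio j V H n T = portfolio j V H' n T"
  using assms by (simp add: portfolio_def)

lemma portfolio_cutoff:
  assumes "j \<le> t"
  shows "portfolio j V (\<lambda>i T. if i < t then H i T else 0) n T = portfolio j V H (min n t) T"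
proof -
  have "(\<Sum>i = j..<n. (if i < t then H i T else 0) * (T (i + 1) - T i))
      = (\<Sum>i\<in>{j..<min n t}. H i T * (T (i + 1) - T i))"
    by (rule sum.mono_neutral_cong_right) auto
  then show ?thesis by (simp add: portfolio_def)
qed

text \<open>The position \<open>H i T\<close> earns the increment from \<open>i\<close> to
  \<open>i + 1\<close>, so the strict bound \<open>enat i < \<tau> T\<close> lets the last increment
  end exactly at \<open>\<tau> T\<close>; the value is frozen from then on.\<close>

lemma portfolio_stopped:
  assumes "enat j \<le> \<tau> T"
  shows "portfolio j V (\<lambda>i T. if enat i < \<tau> T then H i T else 0) n T
    = (case \<tau> T of enat t \<Rightarrow> portfolio j V H (min n t) T | \<infinity> \<Rightarrow> portfolio j V H n T)"
proof (cases "\<tau> T")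
  case (enat t)
  then have "portfolio j V (\<lambda>i T. if enat i < \<tau> T then H i T else 0) n T
      = portfolio j V (\<lambda>i T. if i < t then H i T else 0) n T"
    by (intro portfolio_cong) simp
  then show ?thesis using assms enat by (simp add: portfolio_cutoff)
qed (simp add: portfolio_def)

lemma portfolio_restart:
  assumes "j \<le> t" "t \<le> n"
  shows "portfolio t (portfolio j V H t T) H n T = portfolio j V H n T"
  using assms by (simp add: portfolio_def sum.atLeastLessThan_concat add.assoc)

text \<open>Positions and increments before \<open>n\<close> see only the path up to
  \<open>t\<close>. Hence the value reached at \<open>t\<close> can serve as a single real initial
  capital on the whole node \<open>(T, t)\<close>.\<close>

lemma portfolio_node_cong:
  assumes H: "H \<in> strategies \<S> S j" and T: "T \<in> node \<S> S j" and U: "U \<in> node \<S> T t"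
    and "n \<le> t" "j \<le> t"
  shows "portfolio j V H n U = portfolio j V H n T"
proof -
  have "H i U * (U (i + 1) - U i) = H i T * (T (i + 1) - T i)" if "j \<le> i" "i < n" for i
    using strategiesD[OF H node_trans[OF U T \<open>j \<le> t\<close>] T, of i] that U \<open>n \<le> t\<close>
    by (simp add: node_def)
  then show ?thesis by (simp add: portfolio_def)
qed

section \<open>Upper bounds for the superhedging cost\<close>

lemma elementary_nonneg_portfolio:
  assumes "H \<in> strategies \<S> S j" "j \<le> n" "\<And>T. T \<in> node \<S> S j \<Longrightarrow> 0 \<le> portfolio j V H n T"
  shows "portfolio j V H n \<in> elementary_nonneg \<S> S j"
  using assms unfolding elementary_nonneg_def elementary_def by blast

lemma sigma_node_le:
  assumes "\<And>m. H m \<in> strategies \<S> S j" "j \<le> n0"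
    and "\<And>m n T. 1 \<le> m \<Longrightarrow> j \<le> n \<Longrightarrow> T \<in> node \<S> S j \<Longrightarrow> 0 \<le> portfolio j (V m) (H m) n T"
    and "\<And>T. T \<in> node \<S> S j \<Longrightarrow> f T \<le> (\<Sum>m. hedge j V H n0 m T)"
  shows "sigma_node \<S> j f S \<le> (\<Sum>m. ereal (V m))"
  unfolding sigma_node_def
  using assms by (intro Inf_lower) (blast intro: elementary_nonneg_portfolio)

text \<open>Holding cash \<open>r\<close> without trading is a superhedge for every real
  \<open>r\<close> with \<open>c \<le> r\<close>. The detour over \<open>r\<close> is made because
  \<open>c\<close> may be infinite while capitals are real.\<close>

lemma sigma_node_const_le:
  assumes "\<And>T. T \<in> node \<S> S j \<Longrightarrow> g T \<le> c"
  shows "sigma_node \<S> j g S \<le> c"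
proof (rule ereal_le_real)
  fix r assume "c \<le> ereal r"
  define V :: "nat \<Rightarrow> real" where "V m = (if m = 0 then r else 0)" for m
  have V: "(\<Sum>m. ereal (V m)) = ereal r"
    by (subst suminf_finite[of "{0}"]) (auto simp: V_def zero_ereal_def)
  have hedge: "hedge j V (\<lambda>_ _ _. 0) j m T = ereal (V m)" for m T
    by (simp add: hedge_def portfolio_def Liminf_const)
  have "sigma_node \<S> j g S \<le> (\<Sum>m. ereal (V m))"
  proof (rule sigma_node_le)
    show "g T \<le> (\<Sum>m. hedge j V (\<lambda>_ _ _. 0) j m T)" if "T \<in> node \<S> S j" for T
      using assms[OF that] \<open>c \<le> ereal r\<close> by (simp add: hedge V)
  qed (auto simp: strategies_def portfolio_def V_def)
  then show "sigma_node \<S> j g S \<le> ereal r" by (simp add: V)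
qed

text \<open>Restart each component at \<open>(T, t)\<close> with the capital it has reached there
  along \<open>T\<close>. The final values of all components stay the same, so \<open>f\<close> is
  still superhedged, now at the total of these capitals.\<close>

lemma sigma_node_continuation_le:
  assumes H: "\<And>m. H m \<in> strategies \<S> S j"
    and nonneg: "\<And>m n U. 1 \<le> m \<Longrightarrow> j \<le> n \<Longrightarrow> U \<in> node \<S> S j \<Longrightarrow>
      0 \<le> portfolio j (V m) (H m) n U"
    and hedges: "\<And>U. U \<in> node \<S> S j \<Longrightarrow> f U \<le> (\<Sum>m. hedge j V H n0 m U)"
    and "j \<le> n0" and T: "T \<in> node \<S> S j" and "j \<le> t"
  shows "sigma_node \<S> t f T
    \<le> (\<Sum>m. ereal (portfolio j (V m) (H m) (if m = 0 then min n0 t else t) T))"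
proof -
  \<comment> \<open>The simple portfolio may already be closed at time \<open>t\<close>, namely when \<open>n0 \<le> t\<close>.\<close>
  define G where "G m = (if m = 0 then (\<lambda>i T. if i < n0 then H 0 i T else 0) else H m)" for m
  have G: "G m \<in> strategies \<S> S j" for m
    using H by (auto simp: G_def intro: strategies_if)
  have G0: "portfolio j v (G 0) n U = portfolio j v (H 0) (min n n0) U" for v n U
    using \<open>j \<le> n0\<close> by (simp add: G_def portfolio_cutoff)
  have Gm: "G m = H m" if "m \<noteq> 0" for m
    using that by (simp add: G_def)
  define W where "W m = portfolio j (V m) (G m) t T" for m
  have W: "portfolio j (V m) (H m) (if m = 0 then min n0 t else t) T = W m" for m
    by (cases "m = 0") (simp_all add: W_def G0 Gm min.commute)
  have cont: "portfolio t (W m) (G m) n U = portfolio j (V m) (G m) n U"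
    if "U \<in> node \<S> T t" "t \<le> n" for m n U
    using portfolio_restart[OF \<open>j \<le> t\<close> that(2)]
      portfolio_node_cong[OF G T that(1) order_refl \<open>j \<le> t\<close>]
    unfolding W_def by metis
  have "sigma_node \<S> t f T \<le> (\<Sum>m. ereal (W m))"
  proof (rule sigma_node_le)
    show "G m \<in> strategies \<S> T t" for m
      by (rule strategies_restrict[OF G T \<open>j \<le> t\<close>])
    \<comment> \<open>The new horizon must be at least \<open>t\<close>. As \<open>G 0\<close> holds
      nothing from \<open>n0\<close> on, running to \<open>max n0 t\<close> gives the value at
      \<open>n0\<close>.\<close>
    show "t \<le> max n0 t" by simp
    show "0 \<le> portfolio t (W m) (G m) n U" if "1 \<le> m" "t \<le> n" "U \<in> node \<S> T t" for m n U
      using that cont[OF that(3,2), of m] \<open>j \<le> t\<close> Gm[of m]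
        nonneg[OF that(1) _ node_trans[OF that(3) T \<open>j \<le> t\<close>], of n]
      by simp
    fix U assume U: "U \<in> node \<S> T t"
    have "hedge t W G (max n0 t) m U = hedge j V H n0 m U" for m
    proof (cases "m = 0")
      case True
      then show ?thesis by (simp add: hedge_def cont U G0 min_def)
    next
      case False
      \<comment> \<open>Restarted and original portfolios agree for \<open>n \<ge> t\<close>, which
        is all that a lower limit sees.\<close>
      have "eventually (\<lambda>n. ereal (portfolio t (W m) (G m) n U)
          = ereal (portfolio j (V m) (H m) n U)) sequentially"
        using eventually_ge_at_top[of t]
        by eventually_elim (use cont[OF U, of _ m] Gm[OF False] in simp)
      then show ?thesis using False by (simp add: hedge_def Liminf_eq)
    qed
    then show "f U \<le> (\<Sum>m. hedge t W G (max n0 t) m U)"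
      using hedges[OF node_trans[OF U T \<open>j \<le> t\<close>]] by simp
  qed
  then show ?thesis by (simp add: W)
qed

section \<open>Stopped superhedges\<close>

text \<open>Stopping changes the positions but keeps the capitals \<open>V\<close>, so the bound
  holds for the cost of every superhedge of \<open>f\<close>, and thus for their infimum.\<close>

lemma sigma_node_stopped_le:
  assumes stop: "stopping_time \<S> \<tau>"
    and ge: "\<And>T. T \<in> node \<S> S j \<Longrightarrow> enat j \<le> \<tau> T"
  shows "sigma_node \<S> j (\<lambda>T. sigma_bar \<S> (\<tau> T) f T) S \<le> sigma_node \<S> j f S"
proof -
  have "sigma_node \<S> j (\<lambda>T. sigma_bar \<S> (\<tau> T) f T) S \<le> (\<Sum>m. ereal (V m))"
    if H: "\<And>m. H m \<in> strategies \<S> S j" and "j \<le> n0"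
      and elem: "\<And>m n. 1 \<le> m \<Longrightarrow> j \<le> n \<Longrightarrow>
        portfolio j (V m) (H m) n \<in> elementary_nonneg \<S> S j"
      and hedges: "\<And>T. T \<in> node \<S> S j \<Longrightarrow> f T \<le> (\<Sum>m. hedge j V H n0 m T)"
    for V :: "nat \<Rightarrow> real" and H n0
  proof -
    define G where "G m = (\<lambda>i T. if enat i < \<tau> T then H m i T else 0)" for m
    have nonneg: "0 \<le> portfolio j (V m) (H m) n T"
      if "1 \<le> m" "j \<le> n" "T \<in> node \<S> S j" for m n T
      using elem[OF that(1,2)] that(3) by (simp add: elementary_nonneg_def)
    have stopped: "portfolio j v (G m) n T
      = (case \<tau> T of enat t \<Rightarrow> portfolio j v (H m) (min n t) T | \<infinity> \<Rightarrow> portfolio j v (H m) n T)"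
      if "T \<in> node \<S> S j" for v m n T
      unfolding G_def using ge[OF that] by (rule portfolio_stopped)
    show ?thesis
    proof (rule sigma_node_le)
      show "G m \<in> strategies \<S> S j" for m
        unfolding G_def
        by (rule strategies_if[OF H], rule stopping_time_less_iff[OF stop]) (auto simp: node_def)
      show "j \<le> n0" by fact
      \<comment> \<open>A stopped value is an unstopped one at a time that is still at least
        \<open>j\<close>.\<close>
      show "0 \<le> portfolio j (V m) (G m) n T" if "1 \<le> m" "j \<le> n" "T \<in> node \<S> S j" for m n T
        using that nonneg ge[OF that(3)] by (auto simp: stopped split: enat.split)
      fix T assume T: "T \<in> node \<S> S j"
      show "sigma_bar \<S> (\<tau> T) f T \<le> (\<Sum>m. hedge j V G n0 m T)"
      proof (cases "\<tau> T")
        \<comment> \<open>Nothing is ever stopped on this path, and \<open>sigma_bar\<close> is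
          \<open>f\<close> itself.\<close>
        case infinity
        then have "hedge j V G n0 m T = hedge j V H n0 m T" for m
          by (simp add: hedge_def stopped T)
        then show ?thesis using hedges[OF T] infinity by (simp add: sigma_bar_def)
      next
        case (enat t)
        then have "j \<le> t" using ge[OF T] by simp
        have "hedge j V G n0 m T
            = ereal (portfolio j (V m) (H m) (if m = 0 then min n0 t else t) T)" for m
        proof (cases "m = 0")
          case False
          \<comment> \<open>From \<open>t\<close> on the stopped portfolio is constant, so its lower
            limit is its value at \<open>t\<close>.\<close>
          have "eventually (\<lambda>n. ereal (portfolio j (V m) (G m) n T)
              = ereal (portfolio j (V m) (H m) t T)) sequentially"
            using eventually_ge_at_top[of t]
            by eventually_elim (simp add: stopped T enat min_def)
          from Liminf_eq[OF this] show ?thesis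
            using False by (simp add: hedge_def Liminf_const)
        qed (simp add: hedge_def stopped T enat)
        then show ?thesis
          using sigma_node_continuation_le[OF H nonneg hedges \<open>j \<le> n0\<close> T \<open>j \<le> t\<close>] enat
          by (simp add: sigma_bar_def)
      qed
    qed
  qed
  then show ?thesis
    unfolding sigma_node_def[of \<S> j f S] by (intro Inf_greatest) blast
qed

theorem theorem4p3:
  fixes s0 :: real
    and \<S> :: "(nat \<Rightarrow> real) set"
    and f :: "(nat \<Rightarrow> real) \<Rightarrow> ereal"
    and \<rho> \<tau> :: "(nat \<Rightarrow> real) \<Rightarrow> enat"
    and F :: "enat \<Rightarrow> (nat \<Rightarrow> real) \<Rightarrow> ereal"
  assumes "trajectory_set s0 \<S>"
    and "stopping_time \<S> \<rho>"
    and "stopping_time \<S> \<tau>"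
    and "\<forall>S\<in>\<S>. \<rho> S \<le> \<tau> S"
    and F_eq: "\<And>j. F j = sigma_bar \<S> j f"
  shows "(\<forall>k. \<forall>S\<in>\<S>. sigma_stop \<S> \<rho> (\<lambda>T. F (min (\<tau> T) (enat k)) T) S
                       \<le> F (min (\<rho> S) (enat k)) S)
       \<and> (\<forall>S\<in>\<S>. sigma_stop \<S> \<rho> (\<lambda>T. F (\<tau> T) T) S \<le> F (\<rho> S) S)"
proof (intro conjI allI ballI)
  fix S assume S: "S \<in> \<S>"
  \<comment> \<open>As \<rho> is constant on the node at its own value \<open>j\<close>, the
    inequality between \<rho> and \<tau> bounds \<tau> below by \<open>j\<close> on the whole
    node.\<close>
  have \<rho>_eq: "\<rho> T = \<rho> S" if "T \<in> node \<S> S j" "\<rho> S = enat j" for T j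
  proof -
    have "T \<in> \<S>" "\<forall>i. enat i \<le> \<rho> S \<longrightarrow> S i = T i"
      using that by (simp_all add: node_def)
    then show ?thesis using assms(2) S unfolding stopping_time_def by metis
  qed
  show "sigma_stop \<S> \<rho> (\<lambda>T. F (\<tau> T) T) S \<le> F (\<rho> S) S"
  proof (cases "\<rho> S")
    case (enat j)
    have "enat j \<le> \<tau> T" if "T \<in> node \<S> S j" for T
      using assms(4) \<rho>_eq[OF that enat] that enat by (auto simp: node_def)
    from sigma_node_stopped_le[OF assms(3) this]
    \<comment> \<open>Unfolding at \<open>enat j\<close> alone leaves the inner
      \<open>sigma_bar\<close> at \<open>\<tau> T\<close> folded.\<close>
    show ?thesis by (simp add: sigma_stop_def F_eq sigma_bar_def[of _ "enat j"] enat)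
  next
    case infinity
    \<comment> \<open>Both sides are then \<open>f S\<close>.\<close>
    then have "\<tau> S = \<infinity>" using assms(4) S by force
    then show ?thesis by (simp add: sigma_stop_def sigma_bar_def F_eq infinity)
  qed
  fix k
  show "sigma_stop \<S> \<rho> (\<lambda>T. F (min (\<tau> T) (enat k)) T) S \<le> F (min (\<rho> S) (enat k)) S"
  proof (cases "\<rho> S")
    case (enat j)
    show ?thesis
    proof (cases "j \<le> k")
      case True
      have "enat j \<le> min (\<tau> T) (enat k)" if "T \<in> node \<S> S j" for T
        using assms(4) \<rho>_eq[OF that enat] that enat True by (auto simp: node_def)
      from sigma_node_stopped_le[OF stopping_time_min_const[OF assms(3)] this]
      show ?thesis using True
        by (simp add: sigma_stop_def F_eq sigma_bar_def[of _ "enat j"] enat)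
    next
      case False
      \<comment> \<open>Here \<tau> is at least \<open>j > k\<close> on the node, so the hedged
        function is \<open>F (enat k)\<close>, which depends only on the path up to
        \<open>k\<close>, and the node fixes that path.\<close>
      have "F (min (\<tau> T) (enat k)) T \<le> F (enat k) S" if T: "T \<in> node \<S> S j" for T
      proof -
        have "enat j \<le> \<tau> T"
          using assms(4) \<rho>_eq[OF T enat] T enat by (auto simp: node_def)
        then have "min (\<tau> T) (enat k) = enat k"
          using False by (intro min_absorb2) (metis enat_ord_simps(1) nle_le order_trans)
        moreover have "T \<in> node \<S> S k" using T False by (simp add: node_def)
        ultimately show ?thesis by (simp add: F_eq sigma_bar_def sigma_node_cong)
      qed
      then have "sigma_node \<S> j (\<lambda>T. F (min (\<tau> T) (enat k)) T) S \<le> F (enat k) S"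
        by (rule sigma_node_const_le)
      then show ?thesis using False
        by (simp add: sigma_stop_def sigma_bar_def[of _ "enat j"] enat min_def)
    qed
  next
    case infinity
    \<comment> \<open>Both sides are then \<open>F (enat k) S\<close>.\<close>
    then have "\<tau> S = \<infinity>" using assms(4) S by force
    then show ?thesis by (simp add: sigma_stop_def sigma_bar_def[of _ \<infinity>] infinity)
  qed
qed

end
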